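(* Let $O$ be a locally finite totally ordered set. (1) For all $A,B,C\in\mathscr E_O$ and $\oplus\in\{\trianglelefteq,\not\trianglerighteq\}$: $(A\vee B)\oplus C=(A\oplus C)\vee(B\oplus C)$. (2) For all $A,B,C\in\mathscr E_O$: $A\trianglerighteq(B\vee C)=(A\trianglerighteq B)\vee(A\trianglerighteq C)$. (3) No other distributive law holds in general: for each $\oplus\in\{\trianglelefteq,\not\trianglerighteq,\trianglerighteq,\not\trianglelefteq\}$ and $\circ\in\{\vee,\wedge\}$, each of the identities $(A\circ B)\oplus C=(A\oplus C)\circ(B\oplus C)$ and $A\oplus(B\circ C)=(A\oplus B)\circ(A\oplus C)$ other than those in (1) and (2) fails for some choice of $O$ and $A,B,C\in\mathscr E_O$.
   Context: $\mathscr E_O$ is the set of antichains with respect to inclusion of finite intervals (convex subsets, including $\emptyset$) of $O$, ordered by $A\le B$ iff for every $I\in A$ there is $J\in B$ with $J\subseteq I$; it is a lattice. Operators: $A\not\trianglerighteq B=\{I\in A:\nexists J\in B,\ J\subseteq I\}$, $A\trianglerighteq B=\{I\in A:\exists J\in B,\ J\subseteq I\}$, $A\not\trianglelefteq B=\{I\in A:\nexists J\in B,\ J\supseteq I\}$, $A\trianglelefteq B=\{I\in A:\exists J\in B,\ J\supseteq I\}$. *)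

theory Defs
  imports "HOL-Algebra.Lattice"
begin

text \<open>
  A totally ordered set is a set \<open>X\<close> of elements of a linearly ordered type, with the
  order inherited from the type; intervals and convexity are relative to \<open>X\<close>.
\<close>

definition locally_finite :: "'a::linorder set \<Rightarrow> bool" where
  "locally_finite X \<longleftrightarrow> (\<forall>a\<in>X. \<forall>b\<in>X. finite {x \<in> X. a \<le> x \<and> x \<le> b})"

definition fin_intervals :: "'a::linorder set \<Rightarrow> 'a set set" where
  "fin_intervals X =
     {I. I \<subseteq> X \<and> finite I \<and> (\<forall>x\<in>I. \<forall>y\<in>I. \<forall>z\<in>X. x \<le> z \<and> z \<le> y \<longrightarrow> z \<in> I)}"

text \<open>Antichains may be infinite.\<close>

definition interval_antichains :: "'a::linorder set \<Rightarrow> 'a set set set" where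
  "interval_antichains X = {A. A \<subseteq> fin_intervals X \<and> pairwise (\<lambda>I J. \<not> I \<subseteq> J) A}"

definition antichain_lattice :: "'a::linorder set \<Rightarrow> 'a set set gorder"  (\<open>\<E>\<close>) where
  "antichain_lattice X =
     \<lparr>carrier = interval_antichains X, eq = (=), le = (\<lambda>A B. \<forall>I\<in>A. \<exists>J\<in>B. J \<subseteq> I)\<rparr>"

definition above :: "'a set set \<Rightarrow> 'a set set \<Rightarrow> 'a set set"  (infixl \<open>\<unrhd>\<close> 70) where
  "A \<unrhd> B = {I \<in> A. \<exists>J\<in>B. J \<subseteq> I}"

definition not_above :: "'a set set \<Rightarrow> 'a set set \<Rightarrow> 'a set set"  (infixl \<open>\<not>\<unrhd>\<close> 70) where
  "A \<not>\<unrhd> B = {I \<in> A. \<not> (\<exists>J\<in>B. J \<subseteq> I)}"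

definition below :: "'a set set \<Rightarrow> 'a set set \<Rightarrow> 'a set set"  (infixl \<open>\<unlhd>\<close> 70) where
  "A \<unlhd> B = {I \<in> A. \<exists>J\<in>B. J \<supseteq> I}"

definition not_below :: "'a set set \<Rightarrow> 'a set set \<Rightarrow> 'a set set"  (infixl \<open>\<not>\<unlhd>\<close> 70) where
  "A \<not>\<unlhd> B = {I \<in> A. \<not> (\<exists>J\<in>B. J \<supseteq> I)}"

text \<open>
  The joins and meets of \<open>\<E> X\<close> are chosen by Hilbert's operator; the
  following facts guarantee that they are the least upper and greatest lower bounds.
\<close>

lemma antichain_lattice_simps [simp]:
  "carrier (\<E> X) = interval_antichains X"
  "A .=\<^bsub>\<E> X\<^esub> B \<longleftrightarrow> A = B"
  "A \<sqsubseteq>\<^bsub>\<E> X\<^esub> B \<longleftrightarrow> (\<forall>I\<in>A. \<exists>J\<in>B. J \<subseteq> I)"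
  by (simp_all add: antichain_lattice_def)

definition minimal_members :: "'a set set \<Rightarrow> 'a set set" where
  "minimal_members S = {I \<in> S. \<forall>J\<in>S. J \<subseteq> I \<longrightarrow> J = I}"

lemma minimal_members_subset: "minimal_members S \<subseteq> S"
  by (auto simp: minimal_members_def)

lemma minimal_members_below:
  assumes "S \<subseteq> fin_intervals X" and "I \<in> S"
  shows "\<exists>J\<in>minimal_members S. J \<subseteq> I"
  using \<open>I \<in> S\<close>
proof (induction "card I" arbitrary: I rule: less_induct)
  case less
  show ?case
  proof (cases "I \<in> minimal_members S")
    case False
    then obtain J where J: "J \<in> S" "J \<subset> I"
      using less.prems by (auto simp: minimal_members_def)
    have "finite I"
      using less.prems assms(1) by (auto simp: fin_intervals_def)
    then have "card J < card I"
      using J(2) by (rule psubset_card_mono)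
    from less.hyps[OF this J(1)] J(2) show ?thesis by blast
  qed blast
qed

lemma minimal_members_antichain:
  assumes "S \<subseteq> fin_intervals X"
  shows "minimal_members S \<in> interval_antichains X"
  using assms by (auto simp: interval_antichains_def minimal_members_def pairwise_def)

lemma interval_antichains_antisym:
  assumes "A \<in> interval_antichains X" "\<forall>I\<in>A. \<exists>J\<in>B. J \<subseteq> I" "\<forall>J\<in>B. \<exists>I\<in>A. I \<subseteq> J"
  shows "A \<subseteq> B"
proof
  fix I assume "I \<in> A"
  then obtain J K where "J \<in> B" "J \<subseteq> I" "K \<in> A" "K \<subseteq> J"
    using assms(2,3) by meson
  moreover have "K = I"
    using assms(1) \<open>I \<in> A\<close> \<open>K \<in> A\<close> \<open>K \<subseteq> J\<close> \<open>J \<subseteq> I\<close>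
    by (auto simp: interval_antichains_def dest!: pairwiseD[of _ A K I])
  ultimately show "I \<in> B" by simp
qed

lemma antichain_lattice_partial_order: "partial_order (\<E> X)"
proof
  fix A B
  assume "A \<in> carrier (\<E> X)" "B \<in> carrier (\<E> X)"
    "A \<sqsubseteq>\<^bsub>\<E> X\<^esub> B" "B \<sqsubseteq>\<^bsub>\<E> X\<^esub> A"
  then show "A .=\<^bsub>\<E> X\<^esub> B"
    using interval_antichains_antisym[of A X B] interval_antichains_antisym[of B X A] by simp
next
  fix A B C
  assume "A \<sqsubseteq>\<^bsub>\<E> X\<^esub> B" "B \<sqsubseteq>\<^bsub>\<E> X\<^esub> C"
  then show "A \<sqsubseteq>\<^bsub>\<E> X\<^esub> C"
    by simp (meson subset_trans)
qed (auto simp: antichain_lattice_def)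

lemma least_join:
  assumes "A \<in> interval_antichains X" "B \<in> interval_antichains X"
  shows "least (\<E> X) (minimal_members (A \<union> B))
           (Upper (\<E> X) {A, B})"
proof -
  have S: "A \<union> B \<subseteq> fin_intervals X"
    using assms by (auto simp: interval_antichains_def)
  show ?thesis
  proof (rule least_UpperI)
    show "C \<sqsubseteq>\<^bsub>\<E> X\<^esub> minimal_members (A \<union> B)" if "C \<in> {A, B}" for C
      using that minimal_members_below[OF S] by auto
    show "minimal_members (A \<union> B) \<sqsubseteq>\<^bsub>\<E> X\<^esub> C" if "C \<in> Upper (\<E> X) {A, B}" for C
    proof -
      have "A \<sqsubseteq>\<^bsub>\<E> X\<^esub> C" "B \<sqsubseteq>\<^bsub>\<E> X\<^esub> C"
        using that assms by (auto simp: Upper_def simp del: antichain_lattice_simps(3))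
      then show ?thesis
        using minimal_members_subset[of "A \<union> B"] by (simp add: subset_iff) blast
    qed
  qed (use assms minimal_members_antichain[OF S] in auto)
qed

lemma greatest_meet:
  assumes "A \<in> interval_antichains X" "B \<in> interval_antichains X"
  defines "S \<equiv> {K \<in> fin_intervals X. (\<exists>I\<in>A. I \<subseteq> K) \<and> (\<exists>J\<in>B. J \<subseteq> K)}"
  shows "greatest (\<E> X) (minimal_members S)
           (Lower (\<E> X) {A, B})"
proof -
  have S: "S \<subseteq> fin_intervals X" by (auto simp: S_def)
  show ?thesis
  proof (rule greatest_LowerI)
    show "minimal_members S \<sqsubseteq>\<^bsub>\<E> X\<^esub> C" if "C \<in> {A, B}" for C
      using that minimal_members_subset[of S] by (auto simp: S_def)
    show "C \<sqsubseteq>\<^bsub>\<E> X\<^esub> minimal_members S" if "C \<in> Lower (\<E> X) {A, B}" for C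
    proof -
      have le: "C \<sqsubseteq>\<^bsub>\<E> X\<^esub> A" "C \<sqsubseteq>\<^bsub>\<E> X\<^esub> B" and C: "C \<subseteq> fin_intervals X"
        using that assms(1,2)
        by (auto simp: Lower_def interval_antichains_def simp del: antichain_lattice_simps(3))
      have "I \<in> S" if "I \<in> C" for I
        using that le C unfolding S_def by auto
      then show ?thesis
        using minimal_members_below[OF S] by simp
    qed
  qed (use assms(1,2) minimal_members_antichain[OF S] in auto)
qed

theorem antichain_lattice_lattice: "lattice (\<E> X)"
proof -
  interpret partial_order "\<E> X"
    by (rule antichain_lattice_partial_order)
  show ?thesis
    by unfold_locales (simp, blast intro: least_join greatest_meet)+
qed

end

theory Submission
  imports Defs
begin

text \<open>
  The join of two antichains consists of the minimal members of their union. Both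
  \<open>(\<unlhd>)\<close> and \<open>(\<not>\<unrhd>)\<close> select in their left argument the members
  of an inclusion-closed family, and such a selection commutes with taking minimal members.
  Likewise, an interval contains a minimal member of \<open>B \<union> C\<close> iff it contains a
  member of \<open>B\<close> or of \<open>C\<close>, and subsets of an antichain are already minimal.
  The failures of all other laws occur on the chain \<open>{0, 1}\<close>. Most of them only need the
  comparable antichains \<open>{}\<close>, \<open>{{0}}\<close> and \<open>{{}}\<close>; the remaining three
  come from the meet of \<open>{{0}}\<close> and \<open>{{1}}\<close> being \<open>{{0, 1}}\<close>.
\<close>

text \<open>The lattice join is a Hilbert choice among least upper bounds. Lattice existence makes
  the choice a genuine least upper bound, and uniqueness identifies it with the explicit
  one.\<close>

lemma join_eq_minimal_members:
  assumes "A \<in> interval_antichains X" "B \<in> interval_antichains X"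
  shows "A \<squnion>\<^bsub>\<E> X\<^esub> B = minimal_members (A \<union> B)"
proof -
  interpret lattice "\<E> X" by (rule antichain_lattice_lattice)
  have "least (\<E> X) (A \<squnion>\<^bsub>\<E> X\<^esub> B) (Upper (\<E> X) {A, B})"
    unfolding join_def by (rule sup_of_two_least) (use assms in simp_all)
  from least_unique[OF this least_join[OF assms]] show ?thesis by simp
qed

lemma meet_eq_minimal_members:
  assumes "A \<in> interval_antichains X" "B \<in> interval_antichains X"
  shows "A \<sqinter>\<^bsub>\<E> X\<^esub> B =
    minimal_members {K \<in> fin_intervals X. (\<exists>I\<in>A. I \<subseteq> K) \<and> (\<exists>J\<in>B. J \<subseteq> K)}"
proof -
  interpret lattice "\<E> X" by (rule antichain_lattice_lattice)
  have "greatest (\<E> X) (A \<sqinter>\<^bsub>\<E> X\<^esub> B) (Lower (\<E> X) {A, B})"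
    unfolding meet_def by (rule inf_of_two_greatest) (use assms in simp_all)
  from greatest_unique[OF this greatest_meet[OF assms]] show ?thesis by simp
qed

lemma interval_antichains_subset:
  assumes "A \<in> interval_antichains X" "B \<subseteq> A"
  shows "B \<in> interval_antichains X"
  using assms by (auto simp: interval_antichains_def intro: pairwise_subset)

lemma minimal_members_eq_self:
  assumes "A \<in> interval_antichains X"
  shows "minimal_members A = A"
  using assms by (auto simp: interval_antichains_def minimal_members_def pairwise_def)

text \<open>Any \<open>J\<close> that could refute the minimality of \<open>I\<close> lies inside
  \<open>I\<close>, so it satisfies \<open>P\<close> as soon as \<open>I\<close> does: filtering by
  \<open>P\<close> removes no competitor of a surviving member.\<close>

lemma minimal_members_filter:
  assumes "\<And>I J. P I \<Longrightarrow> J \<subseteq> I \<Longrightarrow> P J"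
  shows "{I \<in> minimal_members S. P I} = minimal_members {I \<in> S. P I}"
  using assms by (auto simp: minimal_members_def)

text \<open>Common form of the laws for \<open>below\<close> and \<open>not_above\<close>: both "has
  a superset in \<open>C\<close>" and "has no subset in \<open>C\<close>" pass to smaller
  sets.\<close>

lemma join_filter_distrib:
  assumes "A \<in> interval_antichains X" "B \<in> interval_antichains X"
    and "\<And>I J. P I \<Longrightarrow> J \<subseteq> I \<Longrightarrow> P J"
  shows "{I \<in> A \<squnion>\<^bsub>\<E> X\<^esub> B. P I} =
    {I \<in> A. P I} \<squnion>\<^bsub>\<E> X\<^esub> {I \<in> B. P I}"
proof -
  have "{I \<in> A. P I} \<in> interval_antichains X" "{I \<in> B. P I} \<in> interval_antichains X"
    using assms(1,2) by (auto intro: interval_antichains_subset)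
  moreover have "{I \<in> A \<union> B. P I} = {I \<in> A. P I} \<union> {I \<in> B. P I}"
    by auto
  ultimately show ?thesis
    using assms(1,2) minimal_members_filter[of P "A \<union> B", OF assms(3)]
    by (simp add: join_eq_minimal_members)
qed

lemma below_join_distrib:
  assumes "A \<in> interval_antichains X" "B \<in> interval_antichains X"
  shows "(A \<squnion>\<^bsub>\<E> X\<^esub> B) \<unlhd> C = (A \<unlhd> C) \<squnion>\<^bsub>\<E> X\<^esub> (B \<unlhd> C)"
  unfolding below_def by (rule join_filter_distrib[OF assms]) blast

lemma not_above_join_distrib:
  assumes "A \<in> interval_antichains X" "B \<in> interval_antichains X"
  shows "(A \<squnion>\<^bsub>\<E> X\<^esub> B) \<not>\<unrhd> C =
    (A \<not>\<unrhd> C) \<squnion>\<^bsub>\<E> X\<^esub> (B \<not>\<unrhd> C)"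
  unfolding not_above_def by (rule join_filter_distrib[OF assms]) blast

lemma above_join_distrib:
  assumes "A \<in> interval_antichains X" "B \<in> interval_antichains X" "C \<in> interval_antichains X"
  shows "A \<unrhd> (B \<squnion>\<^bsub>\<E> X\<^esub> C) = (A \<unrhd> B) \<squnion>\<^bsub>\<E> X\<^esub> (A \<unrhd> C)"
proof -
  have BC: "B \<union> C \<subseteq> fin_intervals X"
    using assms by (auto simp: interval_antichains_def)
  have sub: "A \<unrhd> D \<in> interval_antichains X" for D
    using assms(1) by (rule interval_antichains_subset) (auto simp: above_def)
  have un: "A \<unrhd> B \<union> A \<unrhd> C = A \<unrhd> (B \<union> C)"
    by (auto simp: above_def)
  have "(\<exists>J\<in>minimal_members (B \<union> C). J \<subseteq> I) \<longleftrightarrow> (\<exists>J\<in>B \<union> C. J \<subseteq> I)" for I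
    using minimal_members_below[OF BC] minimal_members_subset[of "B \<union> C"]
    by (meson subset_iff subset_trans)
  then have "A \<unrhd> minimal_members (B \<union> C) = A \<unrhd> (B \<union> C)"
    by (simp only: above_def)
  then show ?thesis
    \<comment> \<open>By \<open>un\<close> the right-hand join is formed from a subset of the
      antichain \<open>A\<close>, where taking minimal members changes nothing.\<close>
    by (simp add: join_eq_minimal_members assms sub un minimal_members_eq_self[OF sub])
qed

lemma meet_eq_left:
  assumes "A \<in> interval_antichains X" "B \<in> interval_antichains X"
    and "\<forall>I\<in>A. \<exists>J\<in>B. J \<subseteq> I"
  shows "A \<sqinter>\<^bsub>\<E> X\<^esub> B = A"
proof -
  interpret lattice "\<E> X" by (rule antichain_lattice_lattice)
  \<comment> \<open>Despite their names, \<open>le_iff_join\<close> expresses the order through the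
    meet and \<open>le_iff_meet\<close> through the join.\<close>
  show ?thesis using le_iff_join[of A B] assms by (simp add: eq_commute)
qed

lemma meet_commute: "A \<sqinter>\<^bsub>\<E> X\<^esub> B = B \<sqinter>\<^bsub>\<E> X\<^esub> A"
  by (simp add: meet_def insert_commute)

lemma join_eq_right:
  assumes "A \<in> interval_antichains X" "B \<in> interval_antichains X"
    and "\<forall>I\<in>A. \<exists>J\<in>B. J \<subseteq> I"
  shows "A \<squnion>\<^bsub>\<E> X\<^esub> B = B"
proof -
  interpret lattice "\<E> X" by (rule antichain_lattice_lattice)
  show ?thesis using le_iff_meet[of A B] assms by simp
qed

lemma join_commute: "A \<squnion>\<^bsub>\<E> X\<^esub> B = B \<squnion>\<^bsub>\<E> X\<^esub> A"
  by (simp add: join_def insert_commute)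

lemma interval_antichains_two:
  "{} \<in> interval_antichains {0, 1 :: int}"
  "{{}} \<in> interval_antichains {0, 1 :: int}"
  "{{0}} \<in> interval_antichains {0, 1 :: int}"
  "{{1}} \<in> interval_antichains {0, 1 :: int}"
  "{{0, 1}} \<in> interval_antichains {0, 1 :: int}"
  "{{0}, {1}} \<in> interval_antichains {0, 1 :: int}"
  by (auto simp: interval_antichains_def fin_intervals_def pairwise_def)

lemma meet_two: "{{0}} \<sqinter>\<^bsub>\<E> {0, 1 :: int}\<^esub> {{1}} = {{0, 1}}"
proof -
  \<comment> \<open>A common lower bound may only use intervals containing both points, and the
    whole chain is the only one.\<close>
  have "{K \<in> fin_intervals {0, 1 :: int}. 0 \<in> K \<and> 1 \<in> K} = {{0, 1}}"
    by (auto simp: fin_intervals_def)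
  then show ?thesis
    by (simp add: meet_eq_minimal_members interval_antichains_two) (auto simp: minimal_members_def)
qed

text \<open>In the order of the lattice \<open>{}\<close> lies below \<open>{{0}}\<close>, which
  lies below \<open>{{}}\<close>, so joins are maxima and meets are minima.\<close>

lemma comparable_two:
  fixes X :: "int set"
  defines "X \<equiv> {0, 1}"
  shows "{} \<squnion>\<^bsub>\<E> X\<^esub> {{0}} = {{0}}" "{{0}} \<squnion>\<^bsub>\<E> X\<^esub> {} = {{0}}"
    "{{}} \<squnion>\<^bsub>\<E> X\<^esub> {{0}} = {{}}" "{{0}} \<squnion>\<^bsub>\<E> X\<^esub> {{}} = {{}}"
    "{} \<sqinter>\<^bsub>\<E> X\<^esub> {{0}} = {}" "{{0}} \<sqinter>\<^bsub>\<E> X\<^esub> {} = {}"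
    "{{}} \<sqinter>\<^bsub>\<E> X\<^esub> {{0}} = {{0}}" "{{0}} \<sqinter>\<^bsub>\<E> X\<^esub> {{}} = {{0}}"
  unfolding X_def
  using join_eq_right[of "{}" "{0, 1 :: int}" "{{0}}"] join_eq_right[of "{{0}}" "{0, 1 :: int}" "{{}}"]
    meet_eq_left[of "{}" "{0, 1 :: int}" "{{0}}"] meet_eq_left[of "{{0}}" "{0, 1 :: int}" "{{}}"]
  by (simp_all add: interval_antichains_two join_commute meet_commute)

text \<open>Recursion on the left argument, so that rewriting evaluates the four operators on
  explicit finite antichains.\<close>

lemma selection_insert:
  "{} \<unlhd> C = {}" "insert I A \<unlhd> C = (if \<exists>J\<in>C. I \<subseteq> J then insert I (A \<unlhd> C) else A \<unlhd> C)"
  "{} \<not>\<unlhd> C = {}" "insert I A \<not>\<unlhd> C = (if \<exists>J\<in>C. I \<subseteq> J then A \<not>\<unlhd> C else insert I (A \<not>\<unlhd> C))"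
  "{} \<unrhd> C = {}" "insert I A \<unrhd> C = (if \<exists>J\<in>C. J \<subseteq> I then insert I (A \<unrhd> C) else A \<unrhd> C)"
  "{} \<not>\<unrhd> C = {}" "insert I A \<not>\<unrhd> C = (if \<exists>J\<in>C. J \<subseteq> I then A \<not>\<unrhd> C else insert I (A \<not>\<unrhd> C))"
  by (auto simp: below_def not_below_def above_def not_above_def)

text \<open>Four operators, two lattice operations and two argument positions give 16 laws; removing
  the three valid ones leaves these 13. In each, exactly one side evaluates to
  \<open>{}\<close>.\<close>

lemma not_distrib_two:
  fixes X :: "int set"
  defines "X \<equiv> {0, 1}"
  shows
    "({{}} \<squnion>\<^bsub>\<E> X\<^esub> {{0}}) \<unrhd> {{0}} \<noteq> ({{}} \<unrhd> {{0}}) \<squnion>\<^bsub>\<E> X\<^esub> ({{0}} \<unrhd> {{0}})"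
    "({{}} \<squnion>\<^bsub>\<E> X\<^esub> {{0}}) \<not>\<unlhd> {{}} \<noteq> ({{}} \<not>\<unlhd> {{}}) \<squnion>\<^bsub>\<E> X\<^esub> ({{0}} \<not>\<unlhd> {{}})"
    "({{0}} \<sqinter>\<^bsub>\<E> X\<^esub> {{1}}) \<unlhd> {{0}, {1}} \<noteq>
       ({{0}} \<unlhd> {{0}, {1}}) \<sqinter>\<^bsub>\<E> X\<^esub> ({{1}} \<unlhd> {{0}, {1}})"
    "({{0}} \<sqinter>\<^bsub>\<E> X\<^esub> {{1}}) \<not>\<unrhd> {{0, 1}} \<noteq>
       ({{0}} \<not>\<unrhd> {{0, 1}}) \<sqinter>\<^bsub>\<E> X\<^esub> ({{1}} \<not>\<unrhd> {{0, 1}})"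
    "({{0}} \<sqinter>\<^bsub>\<E> X\<^esub> {{}}) \<unrhd> {{0}} \<noteq> ({{0}} \<unrhd> {{0}}) \<sqinter>\<^bsub>\<E> X\<^esub> ({{}} \<unrhd> {{0}})"
    "({{0}} \<sqinter>\<^bsub>\<E> X\<^esub> {{}}) \<not>\<unlhd> {{}} \<noteq> ({{0}} \<not>\<unlhd> {{}}) \<sqinter>\<^bsub>\<E> X\<^esub> ({{}} \<not>\<unlhd> {{}})"
    "{{0}} \<unlhd> ({{0}} \<squnion>\<^bsub>\<E> X\<^esub> {{}}) \<noteq> ({{0}} \<unlhd> {{0}}) \<squnion>\<^bsub>\<E> X\<^esub> ({{0}} \<unlhd> {{}})"
    "{{0}} \<not>\<unrhd> ({} \<squnion>\<^bsub>\<E> X\<^esub> {{0}}) \<noteq> ({{0}} \<not>\<unrhd> {}) \<squnion>\<^bsub>\<E> X\<^esub> ({{0}} \<not>\<unrhd> {{0}})"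
    "{{0}} \<not>\<unlhd> ({} \<squnion>\<^bsub>\<E> X\<^esub> {{0}}) \<noteq> ({{0}} \<not>\<unlhd> {}) \<squnion>\<^bsub>\<E> X\<^esub> ({{0}} \<not>\<unlhd> {{0}})"
    "{{0}} \<unlhd> ({{0}} \<sqinter>\<^bsub>\<E> X\<^esub> {{}}) \<noteq> ({{0}} \<unlhd> {{0}}) \<sqinter>\<^bsub>\<E> X\<^esub> ({{0}} \<unlhd> {{}})"
    "{{0}} \<not>\<unrhd> ({} \<sqinter>\<^bsub>\<E> X\<^esub> {{0}}) \<noteq> ({{0}} \<not>\<unrhd> {}) \<sqinter>\<^bsub>\<E> X\<^esub> ({{0}} \<not>\<unrhd> {{0}})"
    "{{0}, {1}} \<unrhd> ({{0}} \<sqinter>\<^bsub>\<E> X\<^esub> {{1}}) \<noteq>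
       ({{0}, {1}} \<unrhd> {{0}}) \<sqinter>\<^bsub>\<E> X\<^esub> ({{0}, {1}} \<unrhd> {{1}})"
    "{{0}} \<not>\<unlhd> ({} \<sqinter>\<^bsub>\<E> X\<^esub> {{0}}) \<noteq> ({{0}} \<not>\<unlhd> {}) \<sqinter>\<^bsub>\<E> X\<^esub> ({{0}} \<not>\<unlhd> {{0}})"
  unfolding X_def by (simp_all add: comparable_two meet_two selection_insert)

theorem theorem25:
  shows
    "(\<forall>X :: 'a::linorder set. locally_finite X \<longrightarrow>
        (\<forall>A\<in>carrier (\<E> X). \<forall>B\<in>carrier (\<E> X). \<forall>C\<in>carrier (\<E> X).
           \<forall>f\<in>{(\<unlhd>), (\<not>\<unrhd>)}. f (A \<squnion>\<^bsub>\<E> X\<^esub> B) C = f A C \<squnion>\<^bsub>\<E> X\<^esub> f B C)) \<and>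
     (\<forall>X :: 'a set. locally_finite X \<longrightarrow>
        (\<forall>A\<in>carrier (\<E> X). \<forall>B\<in>carrier (\<E> X). \<forall>C\<in>carrier (\<E> X).
           A \<unrhd> (B \<squnion>\<^bsub>\<E> X\<^esub> C) = (A \<unrhd> B) \<squnion>\<^bsub>\<E> X\<^esub> (A \<unrhd> C))) \<and>
     (\<forall>f\<in>{(\<unrhd>), (\<not>\<unlhd>)}.
        \<exists>X :: int set. locally_finite X \<and>
          (\<exists>A\<in>carrier (\<E> X). \<exists>B\<in>carrier (\<E> X). \<exists>C\<in>carrier (\<E> X).
             f (A \<squnion>\<^bsub>\<E> X\<^esub> B) C \<noteq> f A C \<squnion>\<^bsub>\<E> X\<^esub> f B C)) \<and>
     (\<forall>f\<in>{(\<unlhd>), (\<not>\<unrhd>), (\<unrhd>), (\<not>\<unlhd>)}.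
        \<exists>X :: int set. locally_finite X \<and>
          (\<exists>A\<in>carrier (\<E> X). \<exists>B\<in>carrier (\<E> X). \<exists>C\<in>carrier (\<E> X).
             f (A \<sqinter>\<^bsub>\<E> X\<^esub> B) C \<noteq> f A C \<sqinter>\<^bsub>\<E> X\<^esub> f B C)) \<and>
     (\<forall>f\<in>{(\<unlhd>), (\<not>\<unrhd>), (\<not>\<unlhd>)}.
        \<exists>X :: int set. locally_finite X \<and>
          (\<exists>A\<in>carrier (\<E> X). \<exists>B\<in>carrier (\<E> X). \<exists>C\<in>carrier (\<E> X).
             f A (B \<squnion>\<^bsub>\<E> X\<^esub> C) \<noteq> f A B \<squnion>\<^bsub>\<E> X\<^esub> f A C)) \<and>
     (\<forall>f\<in>{(\<unlhd>), (\<not>\<unrhd>), (\<unrhd>), (\<not>\<unlhd>)}.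
        \<exists>X :: int set. locally_finite X \<and>
          (\<exists>A\<in>carrier (\<E> X). \<exists>B\<in>carrier (\<E> X). \<exists>C\<in>carrier (\<E> X).
             f A (B \<sqinter>\<^bsub>\<E> X\<^esub> C) \<noteq> f A B \<sqinter>\<^bsub>\<E> X\<^esub> f A C))"
proof -
  \<comment> \<open>All failures share the chain \<open>{0, 1}\<close>; the predicate
    \<open>P\<close> stands for the law being refuted.\<close>
  have witness: "\<exists>X :: int set. locally_finite X \<and>
      (\<exists>A\<in>carrier (\<E> X). \<exists>B\<in>carrier (\<E> X). \<exists>C\<in>carrier (\<E> X). P X A B C)"
    if "P {0, 1} A B C" "{A, B, C} \<subseteq> interval_antichains {0, 1}" for P A B C
    using that by (auto simp: locally_finite_def intro!: exI[of _ "{0, 1}"])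
  note distribs = below_join_distrib not_above_join_distrib above_join_distrib
  show ?thesis
    apply (intro conjI ballI allI impI; (elim insertE emptyE)?; (hypsubst)?)
      apply (simp_all only: antichain_lattice_simps(1) distribs)[3]
    \<comment> \<open>The antichains stay schematic until unification with the inequality for the
      operator at hand fixes them; their membership is checked last.\<close>
    apply (rule witness, rule not_distrib_two, simp add: interval_antichains_two)+
    done
qed

end
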